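(* Let $P$ be a spiked minimal lattice $3$-polytope of size at least seven. Then $P$ is unimodularly equivalent to $$\mathrm{conv}\{(1,0,0),(0,1,0),(-1,0,-a),(0,-1,2k+b)\}$$ for some $(a,b)\in\{(0,0),(0,1),(1,1)\}$ and some integer $k\ge 2$. This polytope has size $k+5$.
   Context: A lattice polytope has vertices in $\mathbb{Z}^d$; its size is $|P\cap\mathbb{Z}^d|$; unimodular equivalence is via affine maps $t$ with $t(\mathbb{Z}^d)=\mathbb{Z}^d$. An affine functional $f$ is integer if $f(\mathbb{Z}^d)\subseteq\mathbb{Z}$. The width of a finite set or polytope $S$ is the minimum over non-constant integer affine functionals $f$ of $\max_S f-\min_S f$ ($0$ if $S$ is not full-dimensional). For a finite $A\subseteq\mathbb{Z}^d$ with $\mathrm{conv}(A)$ of width $>1$, a vertex $v$ of $\mathrm{conv}(A)$ is essential if $\mathrm{conv}(A\setminus\{v\})$ has width at most one; $A$ is minimal if all vertices are essential and quasi-minimal if at most one vertex is non-essential. A lattice polytope $P$ is (quasi-)minimal if $P\cap\mathbb{Z}^d$ is. A quasi-minimal lattice $3$-polytope $P$ is spiked if there is an affine map $\pi:\mathbb{R}^3\to\mathbb{R}^2$ with $\pi(\mathbb{Z}^3)=\mathbb{Z}^2$ such that, with $A'=\pi(P\cap\mathbb{Z}^3)$, every vertex of $\mathrm{conv}(A')$ has a unique preimage in $P\cap\mathbb{Z}^3$ and $\pi$ restricts to a bijection between the essential vertices of $P\cap\mathbb{Z}^3$ and those of $A'$ (computed in $\mathbb{Z}^2$). *)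

theory Defs
  imports "HOL-Analysis.Analysis"
begin

definition integer_points :: "(real ^ 'n) set"
  where "integer_points = {x. \<forall>i. x $ i \<in> \<int>}"

definition affine_map :: "('a::real_vector \<Rightarrow> 'b::real_vector) \<Rightarrow> bool"
  where "affine_map f \<longleftrightarrow> (\<exists>L c. linear L \<and> f = (\<lambda>x. L x + c))"

definition integer_functional :: "(real ^ 'n \<Rightarrow> real) \<Rightarrow> bool"
  where "integer_functional f \<longleftrightarrow> affine_map f \<and> f ` integer_points \<subseteq> \<int>"

(* Intended for finite sets and polytopes.  There Sup and Inf of the image are the maximum and
   the minimum, and in the full-dimensional case the outer Inf is attained.  The empty set has
   affine dimension -1, hence width 0. *)
definition lattice_width :: "(real ^ 'n) set \<Rightarrow> real"
  where "lattice_width S =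
    (if aff_dim S < int CARD('n) then 0
     else Inf {Sup (f ` S) - Inf (f ` S) | f. integer_functional f \<and> \<not> f constant_on UNIV})"

definition vertices :: "'a::real_vector set \<Rightarrow> 'a set"
  where "vertices P = {v. v extreme_point_of P}"

definition lattice_polytope :: "(real ^ 'n) set \<Rightarrow> bool"
  where "lattice_polytope P \<longleftrightarrow> polytope P \<and> vertices P \<subseteq> integer_points"

definition lattice_size :: "(real ^ 'n) set \<Rightarrow> nat"
  where "lattice_size P = card (P \<inter> integer_points)"

definition unimodularly_equivalent :: "(real ^ 'n) set \<Rightarrow> (real ^ 'n) set \<Rightarrow> bool"
  where "unimodularly_equivalent P Q \<longleftrightarrow>
    (\<exists>t. affine_map t \<and> t ` integer_points = integer_points \<and> t ` P = Q)"

definition wide_configuration :: "(real ^ 'n) set \<Rightarrow> bool"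
  where "wide_configuration A \<longleftrightarrow>
    finite A \<and> A \<subseteq> integer_points \<and> 1 < lattice_width (convex hull A)"

(* Only meaningful for wide configurations A. *)
definition essential_vertices :: "(real ^ 'n) set \<Rightarrow> (real ^ 'n) set"
  where "essential_vertices A =
    {v \<in> vertices (convex hull A). lattice_width (convex hull (A - {v})) \<le> 1}"

definition minimal_configuration :: "(real ^ 'n) set \<Rightarrow> bool"
  where "minimal_configuration A \<longleftrightarrow>
    wide_configuration A \<and> vertices (convex hull A) \<subseteq> essential_vertices A"

definition quasi_minimal_configuration :: "(real ^ 'n) set \<Rightarrow> bool"
  where "quasi_minimal_configuration A \<longleftrightarrow>
    wide_configuration A \<and>
    (\<exists>w. vertices (convex hull A) - essential_vertices A \<subseteq> {w})"

definition minimal_polytope :: "(real ^ 'n) set \<Rightarrow> bool"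
  where "minimal_polytope P \<longleftrightarrow>
    lattice_polytope P \<and> minimal_configuration (P \<inter> integer_points)"

definition quasi_minimal_polytope :: "(real ^ 'n) set \<Rightarrow> bool"
  where "quasi_minimal_polytope P \<longleftrightarrow>
    lattice_polytope P \<and> quasi_minimal_configuration (P \<inter> integer_points)"

(* The image \<pi> ` (P \<inter> integer_points) is automatically a wide configuration: composing with \<pi>
   turns a non-constant integer functional on the plane into one on space.  Its essential
   vertices are therefore meaningful.  It may miss lattice points of its convex hull. *)
definition spiked :: "(real ^ 3) set \<Rightarrow> bool"
  where "spiked P \<longleftrightarrow>
    quasi_minimal_polytope P \<and> aff_dim P = 3 \<and>
    (\<exists>\<pi> :: real ^ 3 \<Rightarrow> real ^ 2.
      affine_map \<pi> \<and> \<pi> ` integer_points = integer_points \<and>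
      (\<forall>v \<in> vertices (convex hull (\<pi> ` (P \<inter> integer_points))).
        \<exists>!x. x \<in> P \<inter> integer_points \<and> \<pi> x = v) \<and>
      bij_betw \<pi> (essential_vertices (P \<inter> integer_points))
        (essential_vertices (\<pi> ` (P \<inter> integer_points))))"

definition spiked_tetrahedron :: "int \<Rightarrow> int \<Rightarrow> int \<Rightarrow> (real ^ 3) set"
  where "spiked_tetrahedron a b k = convex hull
    {vector [1, 0, 0], vector [0, 1, 0],
     vector [-1, 0, - of_int a], vector [0, -1, of_int (2 * k + b)]}"

end

theory Submission
  imports Defs
begin

text \<open>
  Project the lattice points of P to the plane. Every essential vertex v of the projection has an
  integer functional with values 0 and 1 on all other points and a value of at least 2 at v. Four
  such vertices are in convex position, so two of them, a and c, span a segment meeting the one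
  spanned by the other two, b and d. Applied to the common point, the four functionals bound all
  four barycentric weights by 1/2; so abcd is a parallelogram, and any further point of the
  projection is its centre. Hence P is a tetrahedron with all other lattice points on a single
  line. A primitive vector of that line completes two of the vertices to lattice coordinates in
  which P has vertices (1,0,0), (0,1,0), (-1,0,\<alpha>) and (0,-1,\<beta>), and shears and reflections
  normalise \<alpha> and \<beta>.
\<close>

section \<open>Affine maps and integer functionals\<close>

lemma affine_map_compose:
  assumes "affine_map f" "affine_map g"
  shows "affine_map (\<lambda>x. f (g x))"
proof -
  obtain L c M d where L: "linear L" "f = (\<lambda>x. L x + c)" and M: "linear M" "g = (\<lambda>x. M x + d)"
    using assms unfolding affine_map_def by blast
  have "linear (L \<circ> M)" using linear_compose[OF M(1) L(1)] .
  moreover have "(\<lambda>x. f (g x)) = (\<lambda>x. (L \<circ> M) x + (L d + c))"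
    using L M by (simp add: linear_add fun_eq_iff algebra_simps)
  ultimately show ?thesis unfolding affine_map_def by blast
qed

lemma affine_map_comb3:
  assumes "affine_map f" "u + v + w = 1"
  shows "f (u *\<^sub>R x + v *\<^sub>R y + w *\<^sub>R z) = u *\<^sub>R f x + v *\<^sub>R f y + w *\<^sub>R f z"
proof -
  obtain L c where L: "linear L" "f = (\<lambda>x. L x + c)"
    using assms unfolding affine_map_def by blast
  have "u *\<^sub>R c + v *\<^sub>R c + w *\<^sub>R c = c"
    using assms(2) by (metis scaleR_add_left scaleR_one)
  then show ?thesis
    using L(1) unfolding L(2) by (simp add: linear_add linear_scale scaleR_add_right algebra_simps)
qed

lemma affine_map_comb2:
  assumes "affine_map f" "u + v = 1"
  shows "f (u *\<^sub>R x + v *\<^sub>R y) = u *\<^sub>R f x + v *\<^sub>R f y"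
  using affine_map_comb3[OF assms(1), of u v 0 x y 0] assms(2) by simp

lemma affine_map_convex_hull:
  assumes "affine_map f"
  shows "f ` (convex hull S) = convex hull (f ` S)"
proof -
  obtain L c where L: "linear L" "f = (\<lambda>x. L x + c)"
    using assms unfolding affine_map_def by blast
  have "f ` X = (+) c ` (L ` X)" for X
    unfolding L(2) by (simp add: image_image add.commute)
  then show ?thesis
    using convex_hull_linear_image[OF L(1), of S] convex_hull_translation[of c "L ` S"] by simp
qed

lemma integer_functionalD:
  "integer_functional f \<Longrightarrow> x \<in> integer_points \<Longrightarrow> f x \<in> \<int>"
  unfolding integer_functional_def by blast

lemma integer_functional_of_int:
  assumes "integer_functional f" "S \<subseteq> integer_points" "x \<in> S"
  obtains n :: int where "f x = of_int n"
  using integer_functionalD[OF assms(1), of x] assms(2,3) Ints_cases by blast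

text \<open>The origin and the standard basis vectors are lattice points, so the linear part
  vanishes on a basis. This lets non-constancy be tested on the lattice, the only place where the
  image of a projection is prescribed.\<close>

lemma constant_on_integer_points:
  fixes f :: "real ^ 'n \<Rightarrow> real"
  assumes "affine_map f" "f constant_on integer_points"
  shows "f constant_on UNIV"
proof -
  obtain L c where L: "linear L" "f = (\<lambda>x. L x + c)"
    using assms unfolding affine_map_def by blast
  obtain k where k: "\<And>x. x \<in> integer_points \<Longrightarrow> f x = k"
    using assms(2) unfolding constant_on_def by blast
  have ax: "axis i 1 \<in> (integer_points :: (real ^ 'n) set)" for i
    by (simp add: integer_points_def axis_def)
  have "0 \<in> (integer_points :: (real ^ 'n) set)"
    by (simp add: integer_points_def)
  then have "c = k" using k[of 0] L by (simp add: linear_0)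
  then have "L (axis i 1) = 0" for i using k[OF ax[of i]] L(2) by simp
  then have "L = (\<lambda>x. 0)"
    by (intro linear_eq_stdbasis[OF L(1) linear_zero]) (auto simp: Basis_vec_def)
  then show ?thesis unfolding constant_on_def L(2) by simp
qed

text \<open>A coordinate function will do. It makes the set in the definition of
  \<open>lattice_width\<close> nonempty, so that a bound on the infimum produces an actual
  functional.\<close>

lemma nonconstant_integer_functional:
  "\<exists>f :: real ^ 'n \<Rightarrow> real. integer_functional f \<and> \<not> f constant_on UNIV"
proof -
  fix i :: 'n
  define f where "f = (\<lambda>x :: real ^ 'n. x $ i)"
  have "linear f" unfolding f_def by (simp add: bounded_linear.linear bounded_linear_vec_nth)
  have "f (axis i 1) \<noteq> f 0" by (simp add: f_def)
  from \<open>linear f\<close> have "affine_map f"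
    unfolding affine_map_def by (intro exI[of _ f] exI[of _ 0]) auto
  then have "integer_functional f"
    by (auto simp: integer_functional_def f_def integer_points_def)
  moreover have "\<not> f constant_on UNIV"
    using \<open>f (axis i 1) \<noteq> f 0\<close> unfolding constant_on_def by (metis UNIV_I)
  ultimately show ?thesis by blast
qed

section \<open>Lattice width expressed by slabs\<close>

lemma bdd_functional_hull:
  fixes f :: "real ^ 'n \<Rightarrow> real"
  assumes "finite S" "affine_map f"
  shows "bdd_above (f ` (convex hull S))" "bdd_below (f ` (convex hull S))"
proof -
  have "bounded (f ` (convex hull S))"
    unfolding affine_map_convex_hull[OF assms(2)]
    using assms(1) finite_imp_bounded_convex_hull by blast
  then show "bdd_above (f ` (convex hull S))" "bdd_below (f ` (convex hull S))"
    by (auto simp: bounded_imp_bdd_above bounded_imp_bdd_below)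
qed

text \<open>An infimum below 2 is undercut by the spread of some functional that is itself below 2.
  Integer values with such a spread lie in two consecutive integers, so the attainment of the
  infimum never enters.\<close>

lemma lattice_width_less_2D:
  fixes S :: "(real ^ 'n) set"
  assumes fin: "finite S" and int: "S \<subseteq> integer_points"
    and dim: "aff_dim S = int CARD('n)" and width: "lattice_width (convex hull S) < 2"
  obtains f and m :: int where "integer_functional f" "\<not> f constant_on UNIV"
    "\<And>x. x \<in> S \<Longrightarrow> f x = m \<or> f x = m + 1"
proof -
  let ?W = "{Sup (f ` (convex hull S)) - Inf (f ` (convex hull S)) | f.
    integer_functional f \<and> \<not> f constant_on UNIV}"
  have "Inf ?W < 2"
    using width dim unfolding lattice_width_def aff_dim_convex_hull by simp
  moreover have "?W \<noteq> {}"
    using nonconstant_integer_functional[where 'n = 'n] by blast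
  ultimately obtain w where w: "w \<in> ?W" "w < 2"
    by (metis (no_types, lifting) cInf_lessD)
  then obtain f where f: "integer_functional f" "\<not> f constant_on UNIV"
    and "w = Sup (f ` (convex hull S)) - Inf (f ` (convex hull S))" by blast
  then have lt: "Sup (f ` (convex hull S)) - Inf (f ` (convex hull S)) < 2" using w(2) by simp
  have aff: "affine_map f" using f by (simp add: integer_functional_def)
  have diff: "f x - f y < 2" if "x \<in> S" "y \<in> S" for x y
  proof -
    have "f x \<le> Sup (f ` (convex hull S))"
      by (intro cSup_upper bdd_functional_hull fin aff imageI hull_inc that)
    moreover have "Inf (f ` (convex hull S)) \<le> f y"
      by (intro cInf_lower bdd_functional_hull fin aff imageI hull_inc that)
    ultimately show ?thesis using lt by linarith
  qed
  have "S \<noteq> {}" using dim by auto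
  then have "Min (f ` S) \<in> f ` S" using fin by simp
  then obtain y where "y \<in> S" "f y = Min (f ` S)" by auto
  then have y: "y \<in> S" "\<And>x. x \<in> S \<Longrightarrow> f y \<le> f x" using fin by auto
  obtain m where m: "f y = of_int m"
    using integer_functional_of_int[OF f(1) int y(1)] .
  have "f x = m \<or> f x = m + 1" if "x \<in> S" for x
  proof -
    obtain n where n: "f x = of_int n"
      using integer_functional_of_int[OF f(1) int \<open>x \<in> S\<close>] .
    have "m \<le> n" "n < m + 2" using y(2)[OF that] diff[OF that y(1)] m n by linarith+
    then have "n = m \<or> n = m + 1" by linarith
    then show ?thesis using n by auto
  qed
  then show ?thesis using that[of f m] f by blast
qed

text \<open>The slab also contains the convex hull, so \<open>f\<close> contributes a spread of at
  most 1 to the infimum that defines the width.\<close>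

lemma lattice_width_greater_1D:
  fixes S :: "(real ^ 'n) set"
  assumes fin: "finite S" and width: "1 < lattice_width (convex hull S)"
    and f: "integer_functional f" "\<not> f constant_on UNIV"
    and slab: "\<And>x. x \<in> S \<Longrightarrow> m \<le> f x \<and> f x \<le> m + 1"
  shows False
proof -
  let ?H = "convex hull S"
  let ?W = "{Sup (f ` ?H) - Inf (f ` ?H) | f. integer_functional f \<and> \<not> f constant_on UNIV}"
  \<comment> \<open>A degenerate hull has width 0 by convention, so a width above 1 forces the
    branch with the infimum.\<close>
  have dim: "\<not> aff_dim ?H < int CARD('n)"
    using width unfolding lattice_width_def by (auto split: if_splits)
  then have w: "1 < Inf ?W"
    using width unfolding lattice_width_def by simp
  have "S \<noteq> {}" using dim by auto
  then have ne: "?H \<noteq> {}" by simp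
  \<comment> \<open>Spreads are nonnegative; this lower bound is what makes the real infimum
    meaningful and allows \<open>cInf_lower\<close>.\<close>
  have "0 \<le> w" if w: "w \<in> ?W" for w
  proof -
    from w obtain g where g: "integer_functional g" "w = Sup (g ` ?H) - Inf (g ` ?H)" by blast
    then have "affine_map g" by (simp add: integer_functional_def)
    then have "Inf (g ` ?H) \<le> Sup (g ` ?H)"
      using ne bdd_functional_hull[OF fin] by (intro cInf_le_cSup) auto
    then show ?thesis using g by simp
  qed
  then have "bdd_below ?W" by (rule bdd_belowI)
  then have "Inf ?W \<le> Sup (f ` ?H) - Inf (f ` ?H)"
    using f by (intro cInf_lower) auto
  also have "\<dots> \<le> 1"
  proof -
    have "f ` ?H \<subseteq> {m..m + 1}"
      unfolding affine_map_convex_hull[OF f(1)[unfolded integer_functional_def, THEN conjunct1]]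
      using slab by (intro hull_minimal) auto
    then have "Sup (f ` ?H) \<le> m + 1" "m \<le> Inf (f ` ?H)"
      using ne by (auto intro!: cSup_least cInf_greatest)
    then show ?thesis by simp
  qed
  finally show False using w by simp
qed

lemma integer_functional_affine_image:
  assumes "integer_functional f"
  shows "integer_functional (\<lambda>x. f x + of_int m)" "integer_functional (\<lambda>x. of_int m - f x)"
proof -
  obtain L c where L: "linear L" "f = (\<lambda>x. L x + c)"
    using assms unfolding affine_map_def integer_functional_def by blast
  have "affine_map (\<lambda>x. f x + of_int m)"
    unfolding affine_map_def L(2) using L(1) by (intro exI[of _ L] exI[of _ "c + of_int m"]) auto
  moreover have "affine_map (\<lambda>x. of_int m - f x)"
    unfolding affine_map_def L(2) using L(1)
    by (intro exI[of _ "\<lambda>x. - L x"] exI[of _ "of_int m - c"]) (auto intro: linear_compose_neg)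
  ultimately show "integer_functional (\<lambda>x. f x + of_int m)" "integer_functional (\<lambda>x. of_int m - f x)"
    using assms unfolding integer_functional_def by (auto simp: image_subset_iff)
qed

text \<open>Without \<open>v\<close> the set fits between two consecutive integer levels of some
  functional, while all of \<open>A\<close> does not, so \<open>v\<close> lies strictly outside that
  slab. A translation, or a reflection if \<open>v\<close> lies below, moves the slab to the levels
  0 and 1. The assumption \<open>dim\<close> guards against the conventional width 0, from which no
  functional could be extracted. Wideness is stated through functionals because in the application
  it is pulled back along the projection.\<close>

lemma essential_vertex_functional:
  fixes A :: "(real ^ 'n) set"
  assumes fin: "finite A" and int: "A \<subseteq> integer_points" and v: "v \<in> A"
    and dim: "aff_dim (A - {v}) = int CARD('n)"
    and width: "lattice_width (convex hull (A - {v})) \<le> 1"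
    and wide: "\<And>f m. integer_functional f \<Longrightarrow> \<not> f constant_on UNIV \<Longrightarrow>
      \<not> (\<forall>x\<in>A. m \<le> f x \<and> f x \<le> m + 1)"
  obtains f where "integer_functional f" "2 \<le> f v"
    "\<And>x. x \<in> A \<Longrightarrow> x \<noteq> v \<Longrightarrow> f x = 0 \<or> f x = 1"
proof -
  obtain f and m :: int where f: "integer_functional f" "\<not> f constant_on UNIV"
    and slab: "\<And>x. x \<in> A - {v} \<Longrightarrow> f x = m \<or> f x = m + 1"
  proof (rule lattice_width_less_2D[of "A - {v}"])
    show "finite (A - {v})" "A - {v} \<subseteq> integer_points" using fin int by auto
    show "lattice_width (convex hull (A - {v})) < 2" using width by linarith
  qed (use dim in auto)
  obtain n where n: "f v = of_int n"
    using integer_functional_of_int[OF f(1) int v] .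
  have "\<not> (m \<le> f v \<and> f v \<le> m + 1)"
  proof
    assume "m \<le> f v \<and> f v \<le> m + 1"
    then have "\<forall>x\<in>A. of_int m \<le> f x \<and> f x \<le> of_int m + 1"
    proof (intro ballI)
      fix x assume "x \<in> A"
      then show "of_int m \<le> f x \<and> f x \<le> of_int m + 1"
        using slab[of x] \<open>m \<le> f v \<and> f v \<le> m + 1\<close> by (cases "x = v") auto
    qed
    then show False using wide[OF f, of "of_int m"] by blast
  qed
  \<comment> \<open>Integrality of \<open>f v\<close> turns lying outside the slab into a distance
    of a full unit from it.\<close>
  then have "n \<ge> m + 2 \<or> n \<le> m - 1" using n by linarith
  then show ?thesis
  proof
    assume n2: "n \<ge> m + 2"
    show ?thesis
    proof (rule that)
      show "integer_functional (\<lambda>x. f x + of_int (- m))"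
        by (rule integer_functional_affine_image(1)[OF f(1)])
      show "2 \<le> f v + of_int (- m)" using n2 n by simp
      show "f x + of_int (- m) = 0 \<or> f x + of_int (- m) = 1" if "x \<in> A" "x \<noteq> v" for x
        using slab[of x] that by auto
    qed
  next
    assume n2: "n \<le> m - 1"
    show ?thesis
    proof (rule that)
      show "integer_functional (\<lambda>x. of_int (m + 1) - f x)"
        by (rule integer_functional_affine_image(2)[OF f(1)])
      show "2 \<le> of_int (m + 1) - f v" using n2 n by simp
      show "of_int (m + 1) - f x = 0 \<or> of_int (m + 1) - f x = 1" if "x \<in> A" "x \<noteq> v" for x
        using slab[of x] that by auto
    qed
  qed
qed

section \<open>Planar configurations with at least four essential vertices\<close>

lemma extreme_point_in_convex_hullD:
  assumes "v extreme_point_of C" "convex C" "N \<subseteq> C" "v \<in> convex hull N"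
  shows "v \<in> N"
proof -
  have "convex hull N \<subseteq> C" using assms by (simp add: hull_minimal)
  then have "v extreme_point_of (convex hull N)"
    using assms unfolding extreme_point_of_def by blast
  then show ?thesis by (rule extreme_point_of_convex_hull)
qed

text \<open>Of three collinear points one lies between the other two, which an extreme point cannot
  do.\<close>

lemma extreme_points_not_collinear:
  assumes "convex C" "\<And>x. x \<in> {a, b, c} \<Longrightarrow> x extreme_point_of C" "distinct [a, b, c]"
  shows "\<not> collinear {a, b, c :: 'a :: euclidean_space}"
proof
  assume "collinear {a, b, c}"
  then have "a \<in> convex hull {b, c} \<or> b \<in> convex hull {c, a} \<or> c \<in> convex hull {a, b}"
    by (auto simp: collinear_between_cases between_mem_segment segment_convex_hull)
  moreover have "a \<in> C" "b \<in> C" "c \<in> C" using assms(2) by (auto simp: extreme_point_of_def)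
  ultimately show False
    using extreme_point_in_convex_hullD[OF assms(2)[of a] assms(1), of "{b, c}"]
      extreme_point_in_convex_hullD[OF assms(2)[of b] assms(1), of "{c, a}"]
      extreme_point_in_convex_hullD[OF assms(2)[of c] assms(1), of "{a, b}"] assms(3) by auto
qed

text \<open>Four points of the plane are affinely dependent and so have a Radon partition.
  Extremality excludes parts with a single point, which leaves two pairs: the diagonals.\<close>

lemma crossing_diagonals:
  fixes C :: "(real ^ 2) set"
  assumes C: "convex C" and Q: "card Q = 4" "\<And>x. x \<in> Q \<Longrightarrow> x extreme_point_of C"
  obtains a b c d s t where "Q = {a, b, c, d}" "distinct [a, b, c, d]"
    "0 \<le> s" "s \<le> 1" "0 \<le> t" "t \<le> 1"
    "s *\<^sub>R a + (1 - s) *\<^sub>R c = t *\<^sub>R b + (1 - t) *\<^sub>R d"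
proof -
  have fin: "finite Q" using Q(1) by (metis card.infinite zero_neq_numeral)
  have QC: "Q \<subseteq> C" using Q(2) by (auto simp: extreme_point_of_def)
  have "affine_dependent Q"
    using affine_dependent_biggerset[OF fin] Q(1) by simp
  then obtain M N where MN: "M \<subseteq> Q" "N \<subseteq> Q" "M \<inter> N = {}"
    "convex hull M \<inter> convex hull N \<noteq> {}" by (rule Radon)
  \<comment> \<open>A one-point part would lie in the hull of the other part, hence by extremality
    in the other part itself, against disjointness.\<close>
  have *: "card X \<ge> 2" if X: "X \<subseteq> Q" "Y \<subseteq> Q" "X \<inter> Y = {}" "convex hull X \<inter> convex hull Y \<noteq> {}" for X Y
  proof (rule ccontr)
    assume "\<not> 2 \<le> card X"
    moreover have "X \<noteq> {}" using X by auto
    moreover have "finite X" using X(1) fin finite_subset by blast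
    ultimately have "card X = 1" by (metis One_nat_def card_gt_0_iff less_2_cases not_le not_gr_zero neq0_conv)
    then obtain v where v: "X = {v}" by (metis card_1_singletonE)
    then have "v \<in> convex hull Y" using X by auto
    then have "v \<in> Y"
      using extreme_point_in_convex_hullD[of v C Y] Q(2) C X QC v by auto
    then show False using v X by auto
  qed
  have "finite M" "finite N" using MN fin finite_subset by blast+
  then have "card M + card N = card (M \<union> N)" using MN by (simp add: card_Un_disjoint)
  moreover have "card (M \<union> N) \<le> card Q" using MN fin by (intro card_mono) auto
  moreover have "card M \<ge> 2" "card N \<ge> 2" using *[of M N] *[of N M] MN by (auto simp: Int_commute)
  ultimately have cards: "card M = 2" "card N = 2" "card (M \<union> N) = card Q" using Q(1) by linarith+
  then have Qeq: "Q = M \<union> N" using MN fin card_subset_eq[of Q "M \<union> N"] by auto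
  obtain a c where ac: "M = {a, c}" "a \<noteq> c" using cards(1) by (auto simp: card_2_iff)
  obtain b d where bd: "N = {b, d}" "b \<noteq> d" using cards(2) by (auto simp: card_2_iff)
  obtain x where x: "x \<in> convex hull {a, c}" "x \<in> convex hull {b, d}"
    using MN(4) ac bd by blast
  obtain s where s: "0 \<le> s" "s \<le> 1" "x = (1 - s) *\<^sub>R c + s *\<^sub>R a"
    using x(1) by (metis in_segment(1) insert_commute segment_convex_hull)
  obtain t where t: "0 \<le> t" "t \<le> 1" "x = (1 - t) *\<^sub>R d + t *\<^sub>R b"
    using x(2) by (metis in_segment(1) insert_commute segment_convex_hull)
  show ?thesis
    using that[of a b c d s t] Qeq ac bd s t MN(3) by (auto simp: add.commute)
qed

text \<open>At the crossing point \<open>f\<close> is at least \<open>2 * s\<close> when computed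
  along one diagonal, and at most 1 along the other.\<close>

lemma crossing_weight_le_half:
  fixes s t :: real and f :: "_ \<Rightarrow> real"
  assumes "affine_map f" "2 \<le> f a" "0 \<le> f c" "f b \<le> 1" "f d \<le> 1"
    "0 \<le> s" "s \<le> 1" "0 \<le> t" "t \<le> 1"
    "s *\<^sub>R a + (1 - s) *\<^sub>R c = t *\<^sub>R b + (1 - t) *\<^sub>R d"
  shows "s \<le> 1/2"
proof -
  have "s * f a + (1 - s) * f c = t * f b + (1 - t) * f d"
    using affine_map_comb2[OF assms(1), of s "1 - s" a c] affine_map_comb2[OF assms(1), of t "1 - t" b d]
      assms(10) by simp
  moreover have "t * f b + (1 - t) * f d \<le> t * 1 + (1 - t) * 1"
    using assms by (intro add_mono mult_left_mono) auto
  then have "t * f b + (1 - t) * f d \<le> 1" by simp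
  moreover have "s * 2 \<le> s * f a" "0 \<le> (1 - s) * f c"
    using assms by (auto intro: mult_left_mono)
  ultimately show ?thesis by linarith
qed

text \<open>In \<open>f a + f c = f b + f d\<close> the left side is at least 2 and the right side
  at most 2, so every bound is an equality.\<close>

lemma parallelogram_values:
  fixes f :: "_ \<Rightarrow> real"
  assumes "affine_map f" "2 \<le> f a" "0 \<le> f c" "f b \<le> 1" "f d \<le> 1" "a + c = b + d"
  shows "f a = 2" "f b = 1" "f c = 0" "f d = 1"
proof -
  have "(1/2) *\<^sub>R a + (1/2) *\<^sub>R c = (1/2) *\<^sub>R b + (1/2) *\<^sub>R d"
    using assms(6) by (metis scaleR_add_right)
  then have "f a + f c = f b + f d"
    using affine_map_comb2[OF assms(1), of "1/2" "1/2" a c]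
      affine_map_comb2[OF assms(1), of "1/2" "1/2" b d] by simp
  then show "f a = 2" "f b = 1" "f c = 0" "f d = 1" using assms by linarith+
qed

lemma affine_hull_3_UNIV:
  fixes a b c :: "real ^ 2"
  assumes "\<not> collinear {a, b, c}"
  shows "affine hull {a, b, c} = UNIV"
proof -
  have "aff_dim {a, b, c} \<ge> 2" using assms by (simp add: collinear_aff_dim)
  moreover have "aff_dim {a, b, c} \<le> 2" using aff_dim_le_DIM[of "{a, b, c}"] by simp
  ultimately have "aff_dim {a, b, c} = int DIM(real ^ 2)" by simp
  then show ?thesis using aff_dim_eq_full by blast
qed

text \<open>Only the functionals of the adjacent vertices \<open>a\<close> and \<open>b\<close> are
  handed on: after subtracting 1 they become the first two coordinates in space, with the centre of
  the parallelogram at the origin.\<close>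

lemma minimal_quadrilateral:
  fixes A E :: "(real ^ 2) set"
  assumes E: "E \<subseteq> A" "\<And>v. v \<in> E \<Longrightarrow> v extreme_point_of (convex hull A)" "card E \<ge> 4"
    and fn: "\<And>v. v \<in> E \<Longrightarrow>
      \<exists>f. integer_functional f \<and> 2 \<le> f v \<and> (\<forall>x\<in>A. x \<noteq> v \<longrightarrow> f x = 0 \<or> f x = 1)"
  obtains a b c d f g where "E = {a, b, c, d}" "distinct [a, b, c, d]"
    "integer_functional f" "integer_functional g"
    "f a = 2" "f b = 1" "f c = 0" "f d = 1" "g a = 1" "g b = 2" "g c = 1" "g d = 0"
    "\<forall>x\<in>A - E. f x = 1 \<and> g x = 1"
proof -
  obtain Q where Q: "Q \<subseteq> E" "card Q = 4"
    using obtain_subset_with_card_n[OF E(3)] by metis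
  have ext: "x extreme_point_of (convex hull A)" if "x \<in> Q" for x
    using E(2) Q(1) that by blast
  obtain a b c d s t where q: "Q = {a, b, c, d}" "distinct [a, b, c, d]"
    and st: "0 \<le> s" "s \<le> 1" "0 \<le> t" "t \<le> 1"
    and cross: "s *\<^sub>R a + (1 - s) *\<^sub>R c = t *\<^sub>R b + (1 - t) *\<^sub>R d"
    by (rule crossing_diagonals[OF convex_convex_hull[of A] Q(2) ext])
  have mem: "a \<in> E" "b \<in> E" "c \<in> E" "d \<in> E" using q Q by auto
  then have memA: "a \<in> A" "b \<in> A" "c \<in> A" "d \<in> A" using E(1) by auto
  obtain fa where fa: "integer_functional fa" "2 \<le> fa a"
    "\<And>x. x \<in> A \<Longrightarrow> x \<noteq> a \<Longrightarrow> fa x = 0 \<or> fa x = 1" using fn[OF mem(1)] by blast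
  obtain fb where fb: "integer_functional fb" "2 \<le> fb b"
    "\<And>x. x \<in> A \<Longrightarrow> x \<noteq> b \<Longrightarrow> fb x = 0 \<or> fb x = 1" using fn[OF mem(2)] by blast
  obtain fc where fc: "integer_functional fc" "2 \<le> fc c"
    "\<And>x. x \<in> A \<Longrightarrow> x \<noteq> c \<Longrightarrow> fc x = 0 \<or> fc x = 1" using fn[OF mem(3)] by blast
  obtain fd where fd: "integer_functional fd" "2 \<le> fd d"
    "\<And>x. x \<in> A \<Longrightarrow> x \<noteq> d \<Longrightarrow> fd x = 0 \<or> fd x = 1" using fn[OF mem(4)] by blast
  have aff: "affine_map fa" "affine_map fb" "affine_map fc" "affine_map fd"
    using fa(1) fb(1) fc(1) fd(1) by (auto simp: integer_functional_def)
  have ne: "a \<noteq> b" "a \<noteq> c" "a \<noteq> d" "b \<noteq> c" "b \<noteq> d" "c \<noteq> d" using q(2) by auto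
  have ba: "0 \<le> fa x \<and> fa x \<le> 1" if "x \<in> A" "x \<noteq> a" for x using fa(3)[OF that] by linarith
  have bb: "0 \<le> fb x \<and> fb x \<le> 1" if "x \<in> A" "x \<noteq> b" for x using fb(3)[OF that] by linarith
  have bc: "0 \<le> fc x \<and> fc x \<le> 1" if "x \<in> A" "x \<noteq> c" for x using fc(3)[OF that] by linarith
  have bd: "0 \<le> fd x \<and> fd x \<le> 1" if "x \<in> A" "x \<noteq> d" for x using fd(3)[OF that] by linarith
  have bounds: "fa b \<le> 1" "0 \<le> fa c" "fa d \<le> 1"
    "fb a \<le> 1" "fb c \<le> 1" "0 \<le> fb d"
    "0 \<le> fc a" "fc b \<le> 1" "fc d \<le> 1"
    "fd a \<le> 1" "0 \<le> fd b" "fd c \<le> 1"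
    by (rule ba[THEN conjunct1] ba[THEN conjunct2] bb[THEN conjunct1] bb[THEN conjunct2]
      bc[THEN conjunct1] bc[THEN conjunct2] bd[THEN conjunct1] bd[THEN conjunct2],
      rule memA, rule ne ne[symmetric])+
  have "s \<le> 1/2"
    by (rule crossing_weight_le_half[OF aff(1) fa(2) bounds(2,1,3) st cross])
  \<comment> \<open>Exchanging the ends of a diagonal replaces its weight by the complement;
    exchanging the diagonals replaces \<open>s\<close> by \<open>t\<close>.\<close>
  moreover have "1 - s \<le> 1/2"
    by (rule crossing_weight_le_half[of fc c a b d "1 - s" t])
      (use aff(3) fc(2) bounds st cross in \<open>auto simp: add.commute\<close>)
  moreover have "t \<le> 1/2"
    by (rule crossing_weight_le_half[of fb b d a c t s])
      (use aff fb(2) bounds st cross in \<open>auto simp: add.commute\<close>)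
  moreover have "1 - t \<le> 1/2"
    by (rule crossing_weight_le_half[of fd d b a c "1 - t" s])
      (use aff fd(2) bounds st cross in \<open>auto simp: add.commute\<close>)
  ultimately have half: "s = 1/2" "t = 1/2" by linarith+
  have "(1/2) *\<^sub>R (a + c) = (1/2) *\<^sub>R (b + d)"
    using cross unfolding half by (simp add: scaleR_add_right)
  then have par: "a + c = b + d" by simp
  note va = parallelogram_values[OF aff(1) fa(2) bounds(2,1,3) par]
  have vb: "fb b = 2" "fb a = 1" "fb d = 0" "fb c = 1"
    using parallelogram_values[OF aff(2) fb(2) bounds(6,4,5)] par by simp_all
  have vc: "fc c = 2" "fc b = 1" "fc a = 0" "fc d = 1"
    using parallelogram_values[OF aff(3) fc(2) bounds(7,8,9)] par by (simp_all add: add.commute)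
  have vd: "fd d = 2" "fd a = 1" "fd b = 0" "fd c = 1"
    using parallelogram_values[OF aff(4) fd(2) bounds(11,10,12)] par by (simp_all add: add.commute)
  have hull: "affine hull {a, b, c} = UNIV"
    using extreme_points_not_collinear[OF convex_convex_hull, of a b c A] E(2) mem q(2)
    by (intro affine_hull_3_UNIV) auto
  have rest: "fa x = 1 \<and> fb x = 1 \<and> x = (1/2) *\<^sub>R a + (1/2) *\<^sub>R c" if x: "x \<in> A" "x \<notin> Q" for x
  proof -
    have "x \<in> affine hull {a, b, c}" using hull by simp
    then obtain u v w where uvw: "x = u *\<^sub>R a + v *\<^sub>R b + w *\<^sub>R c" "u + v + w = 1"
      unfolding affine_hull_3 by blast
    have nex: "x \<noteq> a" "x \<noteq> b" "x \<noteq> c" "x \<noteq> d" using x(2) q(1) by auto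
    have "fa x = u * 2 + v" "fb x = u + v * 2 + w" "fc x = v + w * 2" "fd x = u + w"
      unfolding uvw(1) using affine_map_comb3[OF aff(1) uvw(2)] affine_map_comb3[OF aff(2) uvw(2)]
        affine_map_comb3[OF aff(3) uvw(2)] affine_map_comb3[OF aff(4) uvw(2)] va vb vc vd
      by auto
    moreover have "fa x \<in> {0, 1}" "fb x \<in> {0, 1}" "fc x \<in> {0, 1}" "fd x \<in> {0, 1}"
      using fa(3)[OF x(1)] fb(3)[OF x(1)] fc(3)[OF x(1)] fd(3)[OF x(1)] nex by simp_all
    \<comment> \<open>Both \<open>fa x + fc x\<close> and \<open>fb x + fd x\<close> equal
      \<open>2 * (u + v + w) = 2\<close>, and the summands are 0 or 1, so all four values are
      1.\<close>
    ultimately have half: "v = 0" "u = 1/2" "w = 1/2" and "fa x = 1" "fb x = 1"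
      using uvw(2) by auto
    moreover have "x = (1/2) *\<^sub>R a + (1/2) *\<^sub>R c" unfolding uvw(1) half by simp
    ultimately show ?thesis by blast
  qed
  \<comment> \<open>A fifth element of \<open>E\<close> would be the midpoint of \<open>a\<close>
    and \<open>c\<close>, which is not extreme.\<close>
  have "x \<in> Q" if x: "x \<in> E" for x
  proof (rule ccontr)
    assume "x \<notin> Q"
    then have "x = (1/2) *\<^sub>R a + (1/2) *\<^sub>R c" using rest x E(1) by blast
    then have "x \<in> convex hull {a, c}"
      unfolding convex_hull_2 by (auto intro!: exI[of _ "1/2"])
    then have "x \<in> {a, c}"
      using extreme_point_in_convex_hullD[OF E(2)[OF x] convex_convex_hull, of "{a, c}"] memA
      by (simp add: hull_inc)
    then show False using \<open>x \<notin> Q\<close> q by auto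
  qed
  then have "E = Q" using Q(1) by blast
  then show ?thesis
    using that[of a b c d fa fb] q fa(1) fb(1) va vb rest by blast
qed

section \<open>Unimodular equivalence\<close>

lemma affine_map_inverse:
  fixes f :: "'a :: euclidean_space \<Rightarrow> 'a"
  assumes "affine_map f" "bij f"
  shows "affine_map (inv f)"
proof -
  obtain L c where L: "linear L" "f = (\<lambda>x. L x + c)"
    using assms unfolding affine_map_def by blast
  have "inj L"
    using bij_is_inj[OF assms(2)] unfolding L(2) inj_def by simp
  then obtain M where M: "linear M" "M \<circ> L = id"
    using linear_injective_left_inverse[OF L(1)] by blast
  have "M (L x) = x" for x using M(2) by (metis comp_apply id_apply)
  then have "inv f y = M y + - M c" for y
  proof -
    have "f (inv f y) = y" using assms(2) by (simp add: bij_is_surj surj_f_inv_f)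
    then have "L (inv f y) + c = y" unfolding L(2) .
    then have "M (L (inv f y)) + M c = M y" using linear_add[OF M(1), of "L (inv f y)" c] by simp
    then show ?thesis using \<open>\<And>x. M (L x) = x\<close> by (simp add: algebra_simps)
  qed
  then have "inv f = (\<lambda>y. M y + - M c)" by blast
  then show ?thesis using M(1) unfolding affine_map_def by (intro exI conjI)
qed

text \<open>The definition of unimodular equivalence does not mention invertibility, but symmetry
  and the invariance of the size rest on it. Each standard basis vector is a difference of two
  lattice points, hence of two values of \<open>t\<close>; so the linear part is surjective, and
  injective by equality of dimensions.\<close>

lemma affine_lattice_automorphism_bij:
  fixes t :: "real ^ 'n \<Rightarrow> real ^ 'n"
  assumes t: "affine_map t" "t ` integer_points = integer_points"
  shows "bij t"
proof -
  obtain L c where L: "linear L" "t = (\<lambda>x. L x + c)"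
    using t(1) unfolding affine_map_def by blast
  have "b \<in> range L" if "b \<in> Basis" for b
  proof -
    have "b \<in> integer_points" "0 \<in> (integer_points :: (real ^ 'n) set)"
      using that by (auto simp: integer_points_def Basis_vec_def axis_def)
    then obtain x y where "t x = b" "t y = 0" using t(2) by (metis imageE)
    moreover have "L (x - y) = t x - t y" unfolding linear_diff[OF L(1)] L(2) by simp
    ultimately have "L (x - y) = b" by simp
    then show ?thesis by blast
  qed
  then have "span Basis \<subseteq> range L"
    using linear_subspace_image[OF L(1) subspace_UNIV] by (intro span_minimal) auto
  then have surj: "surj L" by auto
  then have "inj L" using linear_surjective_imp_injective[OF L(1)] by blast
  then have "inj t" unfolding L(2) inj_def by simp
  moreover have "surj t"
  proof (rule surjI)
    fix y show "t (inv L (y - c)) = y" using surj by (simp add: L(2) surj_f_inv_f)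
  qed
  ultimately show ?thesis by (rule bijI)
qed

lemma unimodularly_equivalentI:
  assumes "affine_map f" "\<And>x. f (g x) = x"
    "\<And>x. x \<in> integer_points \<Longrightarrow> f x \<in> integer_points"
    "\<And>x. x \<in> integer_points \<Longrightarrow> g x \<in> integer_points" "f ` P = Q"
  shows "unimodularly_equivalent P Q"
proof -
  have "x \<in> f ` integer_points" if "x \<in> integer_points" for x
    using assms(2)[of x] assms(4)[OF that] by (metis imageI)
  then have "f ` integer_points = integer_points"
    using assms(3) by blast
  then show ?thesis using assms(1,5) unfolding unimodularly_equivalent_def by blast
qed

lemma unimodularly_equivalent_sym:
  assumes "unimodularly_equivalent P Q"
  shows "unimodularly_equivalent Q P"
proof -
  obtain t where t: "affine_map t" "t ` integer_points = integer_points" "t ` P = Q"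
    using assms unfolding unimodularly_equivalent_def by blast
  have bij: "bij t" by (rule affine_lattice_automorphism_bij[OF t(1,2)])
  then have "inv t ` integer_points = integer_points" "inv t ` Q = P"
    using t(2,3) by (metis bij_is_inj image_inv_f_f)+
  then show ?thesis
    using affine_map_inverse[OF t(1) bij] unfolding unimodularly_equivalent_def by blast
qed

lemma unimodularly_equivalent_trans:
  assumes "unimodularly_equivalent P Q" "unimodularly_equivalent Q R"
  shows "unimodularly_equivalent P R"
proof -
  obtain f where f: "affine_map f" "f ` integer_points = integer_points" "f ` P = Q"
    using assms(1) unfolding unimodularly_equivalent_def by blast
  obtain g where g: "affine_map g" "g ` integer_points = integer_points" "g ` Q = R"
    using assms(2) unfolding unimodularly_equivalent_def by blast
  have "(\<lambda>x. g (f x)) ` X = g ` (f ` X)" for X by (simp add: image_image)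
  then show ?thesis
    using affine_map_compose[OF g(1) f(1)] f g unfolding unimodularly_equivalent_def
    by (intro exI[of _ "\<lambda>x. g (f x)"]) simp
qed

lemma unimodularly_equivalent_lattice_size:
  assumes "unimodularly_equivalent P Q"
  shows "lattice_size P = lattice_size Q"
proof -
  obtain t where t: "affine_map t" "t ` integer_points = integer_points" "t ` P = Q"
    using assms unfolding unimodularly_equivalent_def by blast
  have inj: "inj t" using affine_lattice_automorphism_bij[OF t(1,2)] by (rule bij_is_inj)
  then have "Q \<inter> integer_points = t ` (P \<inter> integer_points)"
    using t(2,3) by (metis image_Int)
  then show ?thesis
    unfolding lattice_size_def using inj by (simp add: card_image inj_on_subset)
qed

section \<open>Tetrahedra with two crossing edges\<close>

lemma integer_points_closed:
  shows "x \<in> integer_points \<Longrightarrow> y \<in> integer_points \<Longrightarrow> x + y \<in> integer_points"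
    and "x \<in> integer_points \<Longrightarrow> y \<in> integer_points \<Longrightarrow> x - y \<in> integer_points"
    and "k \<in> \<int> \<Longrightarrow> x \<in> integer_points \<Longrightarrow> k *\<^sub>R x \<in> integer_points"
  by (auto simp: integer_points_def)

lemma vector_3_integer_points [simp]:
  "(vector [x, y, z] :: real ^ 3) \<in> integer_points \<longleftrightarrow> x \<in> \<int> \<and> y \<in> \<int> \<and> z \<in> \<int>"
  by (simp add: integer_points_def forall_3)

lemma vec_3_eq_iff: "(x :: real ^ 3) = y \<longleftrightarrow> x $ 1 = y $ 1 \<and> x $ 2 = y $ 2 \<and> x $ 3 = y $ 3"
  by (simp add: vec_eq_iff forall_3)

text \<open>Seen along the third axis, the edges joining opposite vertices cross at the origin; they
  meet the axis at heights \<open>\<alpha> / 2\<close> and \<open>\<beta> / 2\<close>. Leaving both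
  parameters free lets the normalising moves act on the pair alone.\<close>

definition crossed_tetrahedron :: "int \<Rightarrow> int \<Rightarrow> (real ^ 3) set"
  where "crossed_tetrahedron \<alpha> \<beta> = convex hull
    {vector [1, 0, 0], vector [0, 1, 0], vector [-1, 0, of_int \<alpha>], vector [0, -1, of_int \<beta>]}"

lemma spiked_eq_crossed: "spiked_tetrahedron a b k = crossed_tetrahedron (- a) (2 * k + b)"
  by (simp add: spiked_tetrahedron_def crossed_tetrahedron_def)

text \<open>The projection to the first two coordinates is the square with corners at the plus and
  minus unit vectors, whose only lattice points are the corners and the origin. Over a corner lies
  one vertex, over the origin the axis segment between the midpoints of the two crossing
  edges.\<close>

lemma crossed_tetrahedron_lattice_points:
  assumes "\<alpha> \<le> \<beta>"
  shows "crossed_tetrahedron \<alpha> \<beta> \<inter> integer_points =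
    {vector [1, 0, 0], vector [0, 1, 0], vector [-1, 0, of_int \<alpha>], vector [0, -1, of_int \<beta>]} \<union>
    (\<lambda>z. vector [0, 0, of_int z]) ` {z. \<alpha> \<le> 2 * z \<and> 2 * z \<le> \<beta>}"
    (is "_ = ?V \<union> ?S")
proof (intro equalityI subsetI)
  fix x assume x: "x \<in> crossed_tetrahedron \<alpha> \<beta> \<inter> integer_points"
  then obtain u v y where uv: "0 \<le> u" "0 \<le> v" "u + v = 1"
    and y: "y \<in> convex hull {vector [0, 1, 0], vector [-1, 0, of_int \<alpha>], vector [0, -1, of_int \<beta>]}"
    and xy: "x = u *\<^sub>R vector [1, 0, 0] + v *\<^sub>R y"
    unfolding crossed_tetrahedron_def by (subst (asm) convex_hull_insert) auto
  obtain p q r where pqr: "0 \<le> p" "0 \<le> q" "0 \<le> r" "p + q + r = 1"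
    and yp: "y = p *\<^sub>R vector [0, 1, 0] + q *\<^sub>R vector [-1, 0, of_int \<alpha>] + r *\<^sub>R vector [0, -1, of_int \<beta>]"
    using y unfolding convex_hull_3 by blast
  define u2 u3 u4 where "u2 = v * p" and "u3 = v * q" and "u4 = v * r"
  have nonneg: "0 \<le> u2" "0 \<le> u3" "0 \<le> u4" using uv pqr by (simp_all add: u2_def u3_def u4_def)
  have "v * (p + q + r) = v" using pqr by simp
  then have sum: "u + u2 + u3 + u4 = 1"
    using uv by (simp add: u2_def u3_def u4_def algebra_simps)
  have xc: "x $ 1 = u - u3" "x $ 2 = u2 - u4" "x $ 3 = u3 * \<alpha> + u4 * \<beta>"
    unfolding xy yp by (simp_all add: u2_def u3_def u4_def algebra_simps)
  have "x $ 1 \<in> \<int>" "x $ 2 \<in> \<int>" "x $ 3 \<in> \<int>"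
    using x by (simp_all add: integer_points_def)
  then obtain i j k :: int where ijk: "x $ 1 = i" "x $ 2 = j" "x $ 3 = k"
    by (elim Ints_cases)
  \<comment> \<open>Each of the two differences of weights is bounded by the corresponding sum, and
    all weights add up to 1.\<close>
  have "\<bar>i\<bar> + \<bar>j\<bar> \<le> 1"
    using xc ijk nonneg uv(1) sum by linarith
  then consider "i = 1" "j = 0" | "i = -1" "j = 0" | "i = 0" "j = 1" | "i = 0" "j = -1" | "i = 0" "j = 0"
    by linarith
  then show "x \<in> ?V \<union> ?S"
  proof cases
    case 1
    then have "u3 = 0" "u4 = 0" using xc ijk nonneg uv(1) sum by simp_all
    then have "x = vector [1, 0, 0]" using xc ijk 1 by (simp add: vec_3_eq_iff)
    then show ?thesis by simp
  next
    case 2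
    then have "u3 = 1" "u4 = 0" using xc ijk nonneg uv(1) sum by simp_all
    then have "x = vector [-1, 0, of_int \<alpha>]" using xc ijk 2 by (simp add: vec_3_eq_iff)
    then show ?thesis by simp
  next
    case 3
    then have "u3 = 0" "u4 = 0" using xc ijk nonneg uv(1) sum by simp_all
    then have "x = vector [0, 1, 0]" using xc ijk 3 by (simp add: vec_3_eq_iff)
    then show ?thesis by simp
  next
    case 4
    then have "u3 = 0" "u4 = 1" using xc ijk nonneg uv(1) sum by simp_all
    then have "x = vector [0, -1, of_int \<beta>]" using xc ijk 4 by (simp add: vec_3_eq_iff)
    then show ?thesis by simp
  next
    case 5
    \<comment> \<open>On the axis opposite vertices have equal weights, so \<open>u3\<close> and
      \<open>u4\<close> share one half and the height lies between \<open>\<alpha> / 2\<close> and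
      \<open>\<beta> / 2\<close>.\<close>
    then have u: "u3 = 1/2 - u4" using xc ijk sum by simp
    then have "real_of_int k = (1/2 - u4) * \<alpha> + u4 * \<beta>"
      using xc(3) ijk(3) by simp
    then have "2 * real_of_int k = \<alpha> + 2 * u4 * real_of_int (\<beta> - \<alpha>)"
      by (simp add: algebra_simps)
    moreover have "0 \<le> 2 * u4 * real_of_int (\<beta> - \<alpha>)" using nonneg assms by simp
    moreover have "2 * u4 * real_of_int (\<beta> - \<alpha>) \<le> 1 * real_of_int (\<beta> - \<alpha>)"
      using nonneg u assms by (intro mult_right_mono) auto
    ultimately have "real_of_int \<alpha> \<le> real_of_int (2 * k)" "real_of_int (2 * k) \<le> real_of_int \<beta>"
      by simp_all
    then have "\<alpha> \<le> 2 * k" "2 * k \<le> \<beta>" by (simp_all only: of_int_le_iff)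
    moreover have "x = vector [0, 0, of_int k]" using ijk 5 by (simp add: vec_3_eq_iff)
    ultimately show ?thesis by auto
  qed
next
  let ?H = "crossed_tetrahedron \<alpha> \<beta>"
  have V: "?V \<subseteq> ?H" unfolding crossed_tetrahedron_def by (rule hull_subset)
  have conv: "convex ?H" unfolding crossed_tetrahedron_def by (rule convex_convex_hull)
  \<comment> \<open>The ends of the axis segment are the midpoints of the two crossing
    edges.\<close>
  have "vector [0, 0, \<alpha> / 2] =
      (1/2) *\<^sub>R vector [1, 0, 0] + (1/2) *\<^sub>R (vector [-1, 0, of_int \<alpha>] :: real ^ 3)"
    by (simp add: vec_3_eq_iff)
  also have "\<dots> \<in> ?H" using V by (intro convexD[OF conv]) auto
  finally have mid1: "vector [0, 0, \<alpha> / 2] \<in> ?H" .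
  have "vector [0, 0, \<beta> / 2] =
      (1/2) *\<^sub>R vector [0, 1, 0] + (1/2) *\<^sub>R (vector [0, -1, of_int \<beta>] :: real ^ 3)"
    by (simp add: vec_3_eq_iff)
  also have "\<dots> \<in> ?H" using V by (intro convexD[OF conv]) auto
  finally have mid2: "vector [0, 0, \<beta> / 2] \<in> ?H" .
  fix x assume "x \<in> ?V \<union> ?S"
  then show "x \<in> ?H \<inter> integer_points"
  proof
    assume "x \<in> ?V"
    then show ?thesis using V by auto
  next
    assume "x \<in> ?S"
    then obtain z where z: "\<alpha> \<le> 2 * z" "2 * z \<le> \<beta>" "x = vector [0, 0, of_int z]" by blast
    have "real_of_int z \<in> closed_segment (\<alpha> / 2) (\<beta> / 2)"
      using z by (simp add: closed_segment_eq_real_ivl)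
    then obtain w where w: "0 \<le> w" "w \<le> 1" "real_of_int z = (1 - w) * (\<alpha> / 2) + w * (\<beta> / 2)"
      by (auto simp: in_segment)
    have "x = (1 - w) *\<^sub>R vector [0, 0, \<alpha> / 2] + w *\<^sub>R vector [0, 0, \<beta> / 2]"
      using w z by (simp add: vec_3_eq_iff)
    then have "x \<in> ?H" using convexD[OF conv mid1 mid2] w by simp
    then show ?thesis using z(3) by simp
  qed
qed

text \<open>The axis contributes exactly the heights from 0 to \<open>k\<close>. The weak condition
  on \<open>k\<close>, which admits the empty range at \<open>k = -1\<close>, is all that is known
  when the normal form uses this count to derive \<open>k \<ge> 2\<close>.\<close>

lemma spiked_tetrahedron_size:
  assumes "a \<in> {0, 1}" "b \<in> {0, 1}" "- a \<le> 2 * k + b"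
  shows "lattice_size (spiked_tetrahedron a b k) = 4 + nat (k + 1)"
proof -
  let ?V = "{vector [1, 0, 0], vector [0, 1, 0], vector [-1, 0, of_int (- a)],
    vector [0, -1, of_int (2 * k + b)]} :: (real ^ 3) set"
  let ?h = "\<lambda>z. vector [0, 0, of_int z] :: real ^ 3"
  have "{z. - a \<le> 2 * z \<and> 2 * z \<le> 2 * k + b} = {0..k}"
    using assms by auto
  then have eq: "spiked_tetrahedron a b k \<inter> integer_points = ?V \<union> ?h ` {0..k}"
    using crossed_tetrahedron_lattice_points[OF assms(3)] by (simp only: spiked_eq_crossed)
  have "card ?V = 4" by (simp add: vec_3_eq_iff)
  moreover have "card (?h ` {0..k}) = nat (k + 1)"
    by (subst card_image) (auto simp: inj_on_def vec_3_eq_iff)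
  moreover have "?V \<inter> ?h ` {0..k} = {}" by (auto simp: vec_3_eq_iff)
  ultimately show ?thesis
    unfolding lattice_size_def eq by (subst card_Un_disjoint) auto
qed

lemma crossed_tetrahedron_image:
  assumes "affine_map f" "f ` {vector [1, 0, 0], vector [0, 1, 0], vector [-1, 0, of_int \<alpha>],
    vector [0, -1, of_int \<beta>]} = {vector [1, 0, 0], vector [0, 1, 0], vector [-1, 0, of_int \<gamma>],
    vector [0, -1, of_int \<delta>]}"
  shows "f ` crossed_tetrahedron \<alpha> \<beta> = crossed_tetrahedron \<gamma> \<delta>"
  unfolding crossed_tetrahedron_def affine_map_convex_hull[OF assms(1)] assms(2) by (rule refl)

text \<open>The functional \<open>x $ 1 + x $ 2 - 1\<close> vanishes at the first two vertices and
  is -2 at the other two, so adding \<open>c\<close> times it to the height changes both parameters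
  by the same even number.\<close>

lemma crossed_tetrahedron_shear:
  "unimodularly_equivalent (crossed_tetrahedron \<alpha> \<beta>)
    (crossed_tetrahedron (\<alpha> - 2 * c) (\<beta> - 2 * c))"
proof -
  define h :: "int \<Rightarrow> real ^ 3 \<Rightarrow> real ^ 3"
    where "h = (\<lambda>c x. vector [x $ 1, x $ 2, x $ 3 + of_int c * (x $ 1 + x $ 2 - 1)])"
  have aff: "affine_map (h c)"
    unfolding affine_map_def
    by (intro exI[of _ "\<lambda>x. vector [x $ 1, x $ 2, x $ 3 + of_int c * (x $ 1 + x $ 2)]"]
        exI[of _ "vector [0, 0, - of_int c]"] conjI linearI)
      (auto simp: h_def vec_3_eq_iff algebra_simps fun_eq_iff)
  show ?thesis
  proof (rule unimodularly_equivalentI[OF aff])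
    show "h c (h (- c) x) = x" for x by (simp add: h_def vec_3_eq_iff)
    show "h k x \<in> integer_points" if "x \<in> integer_points" for k x
      using that by (simp add: h_def) (simp add: integer_points_def)
    then show "h k x \<in> integer_points" if "x \<in> integer_points" for k x using that .
    show "h c ` crossed_tetrahedron \<alpha> \<beta> = crossed_tetrahedron (\<alpha> - 2 * c) (\<beta> - 2 * c)"
      by (rule crossed_tetrahedron_image[OF aff]) (simp add: h_def mult.commute)
  qed
qed

lemma crossed_tetrahedron_swap:
  "unimodularly_equivalent (crossed_tetrahedron \<alpha> \<beta>) (crossed_tetrahedron \<beta> \<alpha>)"
proof -
  define h :: "real ^ 3 \<Rightarrow> real ^ 3" where "h = (\<lambda>x. vector [x $ 2, x $ 1, x $ 3])"
  have "linear h"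
    by (intro linearI) (auto simp: h_def vec_3_eq_iff)
  then have aff: "affine_map h"
    unfolding affine_map_def by (intro exI[of _ h] exI[of _ 0]) simp
  show ?thesis
  proof (rule unimodularly_equivalentI[OF aff])
    show "h (h x) = x" for x by (simp add: h_def vec_3_eq_iff)
    show "h x \<in> integer_points" if "x \<in> integer_points" for x
      using that by (simp add: h_def) (simp add: integer_points_def)
    then show "h x \<in> integer_points" if "x \<in> integer_points" for x using that .
    show "h ` crossed_tetrahedron \<alpha> \<beta> = crossed_tetrahedron \<beta> \<alpha>"
      by (rule crossed_tetrahedron_image[OF aff]) (auto simp: h_def)
  qed
qed

lemma crossed_tetrahedron_negate:
  "unimodularly_equivalent (crossed_tetrahedron \<alpha> \<beta>) (crossed_tetrahedron (- \<alpha>) (- \<beta>))"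
proof -
  define h :: "real ^ 3 \<Rightarrow> real ^ 3" where "h = (\<lambda>x. vector [x $ 1, x $ 2, - x $ 3])"
  have "linear h"
    by (intro linearI) (auto simp: h_def vec_3_eq_iff)
  then have aff: "affine_map h"
    unfolding affine_map_def by (intro exI[of _ h] exI[of _ 0]) simp
  show ?thesis
  proof (rule unimodularly_equivalentI[OF aff])
    show "h (h x) = x" for x by (simp add: h_def vec_3_eq_iff)
    show "h x \<in> integer_points" if "x \<in> integer_points" for x
      using that by (simp add: h_def) (simp add: integer_points_def)
    then show "h x \<in> integer_points" if "x \<in> integer_points" for x using that .
    show "h ` crossed_tetrahedron \<alpha> \<beta> = crossed_tetrahedron (- \<alpha>) (- \<beta>)"
      by (rule crossed_tetrahedron_image[OF aff]) (auto simp: h_def)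
  qed
qed

text \<open>After ordering the parameters, a shear brings the smaller one to 0 or -1, and the parity
  of the larger one gives \<open>b\<close>. Of the four resulting pairs, (1, 0) is a mirror image of
  (0, 1).\<close>

lemma crossed_tetrahedron_normal_form:
  assumes size: "7 \<le> lattice_size (crossed_tetrahedron \<alpha> \<beta>)"
  obtains a b k where "(a, b) \<in> {(0, 0), (0, 1), (1, 1)}" "k \<ge> 2"
    "unimodularly_equivalent (crossed_tetrahedron \<alpha> \<beta>) (spiked_tetrahedron a b k)"
proof -
  obtain \<gamma> \<delta> where le: "\<gamma> \<le> \<delta>"
    and gd: "unimodularly_equivalent (crossed_tetrahedron \<alpha> \<beta>) (crossed_tetrahedron \<gamma> \<delta>)"
  proof (cases "\<alpha> \<le> \<beta>")
    case True
    \<comment> \<open>The shear by 0 serves as reflexivity.\<close>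
    then show thesis using that[of \<alpha> \<beta>] crossed_tetrahedron_shear[of \<alpha> \<beta> 0] by simp
  next
    case False
    then show thesis using that[of \<beta> \<alpha>] crossed_tetrahedron_swap[of \<alpha> \<beta>] by simp
  qed
  \<comment> \<open>Half of \<open>\<gamma>\<close> rounded up: the lowest integer height on the
    axis segment is moved to 0.\<close>
  define c where "c = (\<gamma> + 1) div 2"
  define a where "a = 2 * c - \<gamma>"
  define k where "k = (\<delta> - 2 * c) div 2"
  define b where "b = (\<delta> - 2 * c) mod 2"
  have a: "a \<in> {0, 1}" unfolding a_def c_def by auto
  have b: "b \<in> {0, 1}" unfolding b_def by auto
  have kb: "2 * k + b = \<delta> - 2 * c" unfolding k_def b_def by simp
  then have eq: "unimodularly_equivalent (crossed_tetrahedron \<alpha> \<beta>) (spiked_tetrahedron a b k)"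
    using unimodularly_equivalent_trans[OF gd crossed_tetrahedron_shear[of \<gamma> \<delta> c]]
    by (simp add: spiked_eq_crossed a_def)
  have "lattice_size (spiked_tetrahedron a b k) = 4 + nat (k + 1)"
    using le kb by (intro spiked_tetrahedron_size a b) (simp add: a_def)
  then have k: "k \<ge> 2"
    using size unimodularly_equivalent_lattice_size[OF eq] by linarith
  show ?thesis
  proof (cases "(a, b) = (1, 0)")
    case True
    \<comment> \<open>The parameters pass from (-1, 2k) through (1, -2k) and (-2k, 1) to (0, 2k +
      1).\<close>
    have "unimodularly_equivalent (crossed_tetrahedron (- 1) (2 * k)) (crossed_tetrahedron 1 (- (2 * k)))"
      using crossed_tetrahedron_negate[of "- 1" "2 * k"] by simp
    from unimodularly_equivalent_trans[OF this crossed_tetrahedron_swap]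
    have "unimodularly_equivalent (crossed_tetrahedron (- 1) (2 * k)) (crossed_tetrahedron (- (2 * k)) 1)" .
    from unimodularly_equivalent_trans[OF this crossed_tetrahedron_shear[of _ _ "- k"]]
    have "unimodularly_equivalent (spiked_tetrahedron a b k) (spiked_tetrahedron 0 1 k)"
      using True by (simp add: spiked_eq_crossed add.commute)
    from unimodularly_equivalent_trans[OF eq this] show ?thesis using that[of 0 1 k] k by simp
  next
    case False
    then show ?thesis using that[of a b k] a b k eq by auto
  qed
qed

text \<open>\<open>F\<close> and \<open>G\<close> are the first two coordinates. Their linear parts
  take the values (1, 0) and (0, 1) on \<open>p - m\<close> and \<open>q - m\<close>, so a primitive
  lattice vector \<open>u\<close> of their common kernel completes these two to a lattice basis. The
  points \<open>m\<close> and \<open>m'\<close> guarantee a nonzero lattice vector in that kernel.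
  The map \<open>T\<close> goes from the new coordinates to the given ones and sends the origin to
  \<open>m\<close>.\<close>

lemma crossed_tetrahedron_coordinates:
  fixes F G :: "real ^ 3 \<Rightarrow> real"
  assumes F: "integer_functional F" and G: "integer_functional G"
    and int: "{p, q, r, s, m, m'} \<subseteq> integer_points"
    and Fv: "F p = 1" "F q = 0" "F r = -1" "F s = 0" "F m = 0" "F m' = 0"
    and Gv: "G p = 0" "G q = 1" "G r = 0" "G s = -1" "G m = 0" "G m' = 0"
    and ne: "m \<noteq> m'"
  obtains \<alpha> \<beta> where "unimodularly_equivalent (crossed_tetrahedron \<alpha> \<beta>) (convex hull {p, q, r, s})"
proof -
  obtain L c where L: "linear L" "F = (\<lambda>x. L x + c)"
    using F unfolding affine_map_def integer_functional_def by blast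
  obtain M d where M: "linear M" "G = (\<lambda>x. M x + d)"
    using G unfolding affine_map_def integer_functional_def by blast
  have Ldiff: "L (x - y) = F x - F y" and Mdiff: "M (x - y) = G x - G y" for x y
    unfolding linear_diff[OF L(1)] linear_diff[OF M(1)] L(2) M(2) by simp_all
  define K where "K = {z \<in> integer_points. L z = 0 \<and> M z = 0}"
  have Kdiff: "z - of_int k *\<^sub>R w \<in> K" if "z \<in> K" "w \<in> K" for z w and k :: int
    using that unfolding K_def
    by (simp add: integer_points_closed linear_diff[OF L(1)] linear_diff[OF M(1)]
        linear_scale[OF L(1)] linear_scale[OF M(1)])
  obtain i where i: "(m - m') $ i \<noteq> 0" using ne by (auto simp: vec_eq_iff)
  have mK: "m - m' \<in> K" "m' - m \<in> K"
    using int Fv Gv by (auto simp: K_def Ldiff Mdiff integer_points_closed)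
  \<comment> \<open>The coordinate \<open>i\<close>, in which \<open>m\<close> and \<open>m'\<close>
    differ, measures vectors of the kernel; the least positive value it takes on \<open>K\<close>
    singles out \<open>u\<close>.\<close>
  define pos where "pos n \<longleftrightarrow> 0 < n \<and> (\<exists>z\<in>K. z $ i = real n)" for n :: nat
  obtain k :: int where k: "(m - m') $ i = of_int k"
    using mK(1) unfolding K_def integer_points_def by (auto elim: Ints_cases)
  have "pos (nat \<bar>k\<bar>)"
  proof (cases "k > 0")
    case True
    then show ?thesis using mK(1) k unfolding pos_def by (intro conjI bexI[of _ "m - m'"]) auto
  next
    case False
    then show ?thesis using mK(2) k i unfolding pos_def by (intro conjI bexI[of _ "m' - m"]) auto
  qed
  then have "pos (Least pos)" by (rule LeastI)
  then obtain u where n: "0 < Least pos" and u: "u \<in> K" "u $ i = real (Least pos)"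
    unfolding pos_def by blast
  define n where "n = int (Least pos)"
  have n0: "0 < n" "u $ i = of_int n" using n u(2) by (simp_all add: n_def)
  \<comment> \<open>The step of Euclid's algorithm: the remainder would contradict the minimality of u.\<close>
  have u_gen: "t \<in> \<int>" if t: "t *\<^sub>R u \<in> K" for t
  proof -
    have "(t *\<^sub>R u) $ i \<in> \<int>" using t unfolding K_def integer_points_def by blast
    then obtain j :: int where "(t *\<^sub>R u) $ i = of_int j" by (rule Ints_cases)
    then have j: "t * of_int n = of_int j" using n0 by simp
    define z where "z = t *\<^sub>R u - of_int (j div n) *\<^sub>R u"
    have "z \<in> K" unfolding z_def by (rule Kdiff[OF t u(1)])
    moreover have "z $ i = of_int (j mod n)"
    proof -
      have "z $ i = of_int j - of_int (j div n) * of_int n"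
        unfolding z_def using j n0 by simp
      also have "\<dots> = of_int (j - j div n * n)" by simp
      finally show ?thesis by (simp only: minus_div_mult_eq_mod)
    qed
    moreover have "0 \<le> j mod n" "j mod n < n" using n0 by simp_all
    ultimately have "\<not> 0 < j mod n"
      using not_less_Least[of "nat (j mod n)" pos] unfolding pos_def n_def by fastforce
    then have "j mod n = 0" using \<open>0 \<le> j mod n\<close> by linarith
    then have "j = j div n * n" by auto
    then have "t * of_int n = of_int (j div n) * of_int n" using j by (metis of_int_mult)
    then have "t = of_int (j div n)" using n0 by simp
    then show ?thesis by simp
  qed
  define D where "D = (\<lambda>x :: real ^ 3. x $ 1 *\<^sub>R (p - m) + x $ 2 *\<^sub>R (q - m) + x $ 3 *\<^sub>R u)"
  define T where "T = (\<lambda>x. D x + m)"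
  have linD: "linear D"
    by (intro linearI) (simp_all add: D_def scaleR_add_left scaleR_add_right)
  have aff: "affine_map T" unfolding affine_map_def T_def using linD by blast
  have LD: "L (D x) = x $ 1" and MD: "M (D x) = x $ 2" for x
    using u(1) Fv Gv unfolding D_def K_def
    by (simp_all add: linear_add[OF L(1)] linear_add[OF M(1)] linear_scale[OF L(1)]
        linear_scale[OF M(1)] Ldiff Mdiff)
  have FT: "F (T x) = x $ 1" and GT: "G (T x) = x $ 2" for x
    using LD[of x] MD[of x] Ldiff[of "T x" m] Mdiff[of "T x" m] Fv Gv by (simp_all add: T_def)
  have "u \<noteq> 0" using n0 by auto
  have "x = 0" if "D x = 0" for x
  proof -
    have "x $ 1 = 0" "x $ 2 = 0"
      using LD[of x] MD[of x] that by (simp_all add: linear_0[OF L(1)] linear_0[OF M(1)])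
    moreover from this have "x $ 3 = 0" using that \<open>u \<noteq> 0\<close> by (simp add: D_def)
    ultimately show ?thesis by (simp add: vec_3_eq_iff)
  qed
  then have "inj D" using linear_injective_0[OF linD] by blast
  then have surj: "surj D" using linear_injective_imp_surjective[OF linD] by blast
  have T_int: "x \<in> integer_points \<longleftrightarrow> T x \<in> integer_points" for x
  proof
    assume x: "x \<in> integer_points"
    then have "x $ 1 \<in> \<int>" "x $ 2 \<in> \<int>" "x $ 3 \<in> \<int>" by (simp_all add: integer_points_def)
    then show "T x \<in> integer_points"
      using int u(1) unfolding T_def D_def K_def by (auto intro!: integer_points_closed)
  next
    \<comment> \<open>\<open>F\<close> and \<open>G\<close> recover the first two coordinates as
      integers. What remains is a lattice vector \<open>x $ 3 *\<^sub>R u\<close> in the kernel, and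
      primitivity of \<open>u\<close> makes the third coordinate an integer.\<close>
    assume Tx: "T x \<in> integer_points"
    then have x12: "x $ 1 \<in> \<int>" "x $ 2 \<in> \<int>"
      using integer_functionalD[OF F Tx] integer_functionalD[OF G Tx] by (simp_all add: FT GT)
    have eq: "x $ 3 *\<^sub>R u = T x - m - (x $ 1 *\<^sub>R (p - m) + x $ 2 *\<^sub>R (q - m))"
      by (simp add: T_def D_def)
    have "x $ 3 *\<^sub>R u \<in> integer_points"
      unfolding eq using int Tx x12 by (auto intro!: integer_points_closed)
    then have "x $ 3 *\<^sub>R u \<in> K"
      using u(1) by (simp add: K_def linear_scale[OF L(1)] linear_scale[OF M(1)])
    then show "x \<in> integer_points"
      using u_gen x12 by (simp add: integer_points_def forall_3)
  qed
  have T_surj: "\<exists>x. T x = y" for y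
    using surj unfolding T_def by (metis diff_add_cancel surj_def)
  have coord: "\<exists>j :: int. y = T (vector [F y, G y, of_int j])" if "y \<in> integer_points" for y
  proof -
    obtain x where x: "T x = y" using T_surj by blast
    then have "x \<in> integer_points" using T_int[of x] that by simp
    then obtain j :: int where "x $ 3 = of_int j"
      unfolding integer_points_def by (auto elim: Ints_cases)
    then have "x = vector [F y, G y, of_int j]" using FT[of x] GT[of x] x by (simp add: vec_3_eq_iff)
    then have "y = T (vector [F y, G y, of_int j])" using x by simp
    then show ?thesis by (rule exI)
  qed
  obtain \<alpha> where \<alpha>: "r = T (vector [-1, 0, of_int \<alpha>])" using coord[of r] int Fv Gv by auto
  obtain \<beta> where \<beta>: "s = T (vector [0, -1, of_int \<beta>])" using coord[of s] int Fv Gv by auto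
  have pq: "T (vector [1, 0, 0]) = p" "T (vector [0, 1, 0]) = q" by (simp_all add: T_def D_def)
  have "T ` integer_points = integer_points"
  proof (intro equalityI subsetI)
    fix y :: "real ^ 3" assume "y \<in> integer_points"
    moreover obtain x where "T x = y" using T_surj by blast
    ultimately show "y \<in> T ` integer_points" using T_int[of x] by blast
  qed (use T_int in auto)
  moreover have "T ` crossed_tetrahedron \<alpha> \<beta> = convex hull {p, q, r, s}"
    unfolding crossed_tetrahedron_def affine_map_convex_hull[OF aff] \<alpha> \<beta> by (simp add: pq)
  ultimately have "unimodularly_equivalent (crossed_tetrahedron \<alpha> \<beta>) (convex hull {p, q, r, s})"
    using aff unfolding unimodularly_equivalent_def by blast
  then show ?thesis by (rule that)
qed

section \<open>From a spiked polytope to its planar projection\<close>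

lemma lattice_polytope_hull:
  assumes "lattice_polytope P"
  shows "convex hull vertices P = P" "convex hull (P \<inter> integer_points) = P"
proof -
  have P: "compact P" "convex P" "vertices P \<subseteq> integer_points"
    using assms polytope_imp_compact polytope_imp_convex unfolding lattice_polytope_def by auto
  show hull: "convex hull vertices P = P"
    unfolding vertices_def using Krein_Milman_Minkowski[OF P(1,2)] by simp
  have "vertices P \<subseteq> P" by (auto simp: vertices_def extreme_point_of_def)
  then have "convex hull vertices P \<subseteq> convex hull (P \<inter> integer_points)"
    using P(3) by (intro hull_mono) auto
  moreover have "convex hull (P \<inter> integer_points) \<subseteq> P"
    using P(2) by (intro hull_minimal) auto
  ultimately show "convex hull (P \<inter> integer_points) = P" using hull by simp
qed

lemma integer_functional_compose:
  assumes "integer_functional f" "affine_map \<pi>" "\<pi> ` integer_points \<subseteq> integer_points"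
  shows "integer_functional (\<lambda>x. f (\<pi> x))"
  using assms affine_map_compose[of f \<pi>] unfolding integer_functional_def by blast

text \<open>Surjectivity of \<open>\<pi>\<close> is known on lattice points only, so constancy is
  first transferred to the lattice and from there to the whole space.\<close>

lemma nonconstant_functional_compose:
  fixes f :: "real ^ 'n \<Rightarrow> real" and \<pi> :: "real ^ 'm \<Rightarrow> real ^ 'n"
  assumes f: "affine_map f" "\<not> f constant_on UNIV"
    and \<pi>: "\<pi> ` integer_points = integer_points"
  shows "\<not> (\<lambda>x. f (\<pi> x)) constant_on UNIV"
proof
  assume "(\<lambda>x. f (\<pi> x)) constant_on UNIV"
  then obtain k where "f (\<pi> x) = k" for x unfolding constant_on_def by auto
  then have "f y = k" if "y \<in> integer_points" for y using \<pi> that by (metis imageE)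
  then have "f constant_on integer_points" unfolding constant_on_def by blast
  then show False using constant_on_integer_points f by blast
qed

text \<open>At least three extreme points survive the removal of \<open>v\<close>, and they are not
  collinear. This supplies the dimension assumption of
  \<open>essential_vertex_functional\<close>.\<close>

lemma aff_dim_minus_extreme_point:
  fixes A E :: "(real ^ 2) set"
  assumes E: "E \<subseteq> A" "\<And>v. v \<in> E \<Longrightarrow> v extreme_point_of (convex hull A)" "4 \<le> card E"
  shows "aff_dim (A - {v}) = 2"
proof -
  have "3 \<le> card (E - {v})" using E(3) by (cases "v \<in> E") (auto simp: card_Diff_singleton)
  then obtain T where "T \<subseteq> E - {v}" "card T = 3"
    using obtain_subset_with_card_n by metis
  then obtain x y z where T: "{x, y, z} \<subseteq> E - {v}" "distinct [x, y, z]"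
    by (auto simp: card_3_iff)
  have "\<not> collinear {x, y, z}"
    using T E(2) by (intro extreme_points_not_collinear[OF convex_convex_hull[of A]]) auto
  then have "2 \<le> aff_dim {x, y, z}" by (simp add: collinear_aff_dim)
  also have "\<dots> \<le> aff_dim (A - {v})" using T(1) E(1) by (intro aff_dim_subset) auto
  finally show ?thesis using aff_dim_le_DIM[of "A - {v}"] by simp
qed

text \<open>By minimality the essential vertices are all the vertices of \<open>P\<close>, so they
  span it and number at least four. The bijection in \<open>spiked\<close> carries this count to the
  plane, where \<open>minimal_quadrilateral\<close> reduces it to exactly four.\<close>

lemma spiked_minimal_projection:
  fixes P :: "(real ^ 3) set"
  assumes "spiked P" "minimal_polytope P" and size: "7 \<le> lattice_size P"
  obtains \<alpha> \<beta> where "unimodularly_equivalent (crossed_tetrahedron \<alpha> \<beta>) P"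
proof -
  define A where "A = P \<inter> integer_points"
  define E where "E = essential_vertices A"
  have poly: "lattice_polytope P" and min: "minimal_configuration A"
    using assms(2) by (simp_all add: minimal_polytope_def A_def)
  have hullA: "convex hull A = P" using lattice_polytope_hull(2)[OF poly] by (simp add: A_def)
  have finA: "finite A" and width: "1 < lattice_width (convex hull A)"
    using min by (simp_all add: minimal_configuration_def wide_configuration_def)
  have intA: "A \<subseteq> integer_points" by (simp add: A_def)
  have E_eq: "E = vertices P"
    using min hullA unfolding E_def minimal_configuration_def essential_vertices_def by auto
  have hullE: "convex hull E = P" using lattice_polytope_hull(1)[OF poly] E_eq by simp
  have EA: "E \<subseteq> A"
    using poly unfolding E_eq A_def lattice_polytope_def
    by (auto simp: vertices_def extreme_point_of_def)
  have dimP: "aff_dim P = 3" using assms(1) by (simp add: spiked_def)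
  obtain \<pi> :: "real ^ 3 \<Rightarrow> real ^ 2" where \<pi>: "affine_map \<pi>" "\<pi> ` integer_points = integer_points"
    and fibre: "\<And>v. v \<in> vertices (convex hull (\<pi> ` A)) \<Longrightarrow> \<exists>!x. x \<in> A \<and> \<pi> x = v"
    and bij: "bij_betw \<pi> E (essential_vertices (\<pi> ` A))"
    using assms(1) unfolding spiked_def A_def E_def by auto
  define B where "B = \<pi> ` A"
  define E' where "E' = essential_vertices B"
  have E'_vert: "v extreme_point_of (convex hull B)" if "v \<in> E'" for v
    using that by (simp add: E'_def essential_vertices_def vertices_def)
  have E'B: "E' \<subseteq> B" using E'_vert extreme_point_of_convex_hull by blast
  have \<pi>E: "\<pi> ` E = E'" "card E' = card E"
    using bij bij_betw_imp_surj_on bij_betw_same_card unfolding E'_def B_def by (blast, metis)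
  have "finite E" using EA finA finite_subset by blast
  then have "aff_dim E \<le> int (card E) - 1" by (rule aff_dim_le_card)
  moreover have "aff_dim E = 3" using dimP hullE aff_dim_convex_hull by metis
  ultimately have card: "4 \<le> card E'" using \<pi>E(2) by linarith
  have finB: "finite B" and intB: "B \<subseteq> integer_points"
    using finA intA \<pi>(2) by (auto simp: B_def)
  \<comment> \<open>A slab around the projection would pull back along \<open>\<pi>\<close> to a
    slab around \<open>A\<close>.\<close>
  have wideB: "\<not> (\<forall>x\<in>B. m \<le> f x \<and> f x \<le> m + 1)"
    if f: "integer_functional f" "\<not> f constant_on UNIV" for f m
  proof
    assume slab: "\<forall>x\<in>B. m \<le> f x \<and> f x \<le> m + 1"
    have "affine_map f" using f(1) by (simp add: integer_functional_def)
    then show False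
      using lattice_width_greater_1D[OF finA width integer_functional_compose[OF f(1) \<pi>(1)]
          nonconstant_functional_compose[OF _ f(2) \<pi>(2)], of m] slab \<pi>(2) by (simp add: B_def)
  qed
  have fn: "\<exists>f. integer_functional f \<and> 2 \<le> f v \<and> (\<forall>x\<in>B. x \<noteq> v \<longrightarrow> f x = 0 \<or> f x = 1)"
    if v: "v \<in> E'" for v
  proof (rule essential_vertex_functional[OF finB intB _ _ _ wideB])
    show "v \<in> B" using v E'B by blast
    show "aff_dim (B - {v}) = int CARD(2)"
      using aff_dim_minus_extreme_point[OF E'B E'_vert card] by simp
    show "lattice_width (convex hull (B - {v})) \<le> 1"
      using v by (simp add: E'_def essential_vertices_def)
  qed blast+
  obtain a b c d f g where E': "E' = {a, b, c, d}" and "distinct [a, b, c, d]" and fg: "integer_functional f" "integer_functional g"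
    and f: "f a = 2" "f b = 1" "f c = 0" "f d = 1" and g: "g a = 1" "g b = 2" "g c = 1" "g d = 0"
    and rest: "\<forall>x\<in>B - E'. f x = 1 \<and> g x = 1"
    by (rule minimal_quadrilateral[OF E'B E'_vert card fn])
  have "a \<in> \<pi> ` E" "b \<in> \<pi> ` E" "c \<in> \<pi> ` E" "d \<in> \<pi> ` E"
    unfolding \<pi>E(1) E' by simp_all
  then obtain p q r s where pE: "p \<in> E" "q \<in> E" "r \<in> E" "s \<in> E"
    and p: "\<pi> p = a" "\<pi> q = b" "\<pi> r = c" "\<pi> s = d" by (elim imageE) simp
  \<comment> \<open>Uniqueness of preimages over vertices enters here: every other point of
    \<open>A\<close> projects outside \<open>E'\<close>, hence to the centre.\<close>
  have over: "x \<in> {p, q, r, s}" if x: "x \<in> A" "\<pi> x \<in> E'" for x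
  proof -
    have "\<pi> x \<in> vertices (convex hull (\<pi> ` A))" using E'_vert[OF x(2)] by (simp add: vertices_def B_def)
    then have "y = x" if "y \<in> A" "\<pi> y = \<pi> x" for y using fibre[of "\<pi> x"] x(1) that by blast
    moreover have "\<exists>y\<in>{p, q, r, s}. \<pi> y = \<pi> x" using x(2) p unfolding E' by auto
    ultimately show ?thesis using pE EA by blast
  qed
  have Epq: "E = {p, q, r, s}" using over pE EA \<pi>E(1) by blast
  \<comment> \<open>Size seven leaves at least three lattice points over the centre; two distinct
    ones fix the direction of their line.\<close>
  have "card {p, q, r, s} \<le> 4" by (auto intro!: card_insert_le_m1)
  moreover have "card A \<ge> 7" using size by (simp add: lattice_size_def A_def)
  ultimately have "3 \<le> card (A - {p, q, r, s})"
    using diff_card_le_card_Diff[of "{p, q, r, s}" A] by simp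
  then obtain T where "T \<subseteq> A - {p, q, r, s}" "card T = 3"
    using obtain_subset_with_card_n by metis
  then obtain m m' where m: "m \<in> A - {p, q, r, s}" "m' \<in> A - {p, q, r, s}" "m \<noteq> m'"
    by (auto simp: card_3_iff)
  have centre: "f (\<pi> x) = 1 \<and> g (\<pi> x) = 1" if "x \<in> A - {p, q, r, s}" for x
    using rest over[of x] that by (auto simp: B_def)
  define F where "F = (\<lambda>x. f (\<pi> x) + of_int (- 1))"
  define G where "G = (\<lambda>x. g (\<pi> x) + of_int (- 1))"
  have FG: "integer_functional F" "integer_functional G"
    unfolding F_def G_def using integer_functional_compose[OF fg(1) \<pi>(1)]
      integer_functional_compose[OF fg(2) \<pi>(1)] \<pi>(2)
    by (intro integer_functional_affine_image(1); simp)+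
  show ?thesis
  proof (rule crossed_tetrahedron_coordinates[OF FG, of p q r s m m'])
    show "{p, q, r, s, m, m'} \<subseteq> integer_points" using pE EA intA m by blast
    show "F p = 1" "F q = 0" "F r = -1" "F s = 0" "F m = 0" "F m' = 0"
      using f p centre[OF m(1)] centre[OF m(2)] by (simp_all add: F_def)
    show "G p = 0" "G q = 1" "G r = 0" "G s = -1" "G m = 0" "G m' = 0"
      using g p centre[OF m(1)] centre[OF m(2)] by (simp_all add: G_def)
  qed (use m(3) that hullE Epq in auto)
qed

theorem theorem7:
  shows "(\<forall>P :: (real ^ 3) set. spiked P \<and> minimal_polytope P \<and> lattice_size P \<ge> 7 \<longrightarrow>
            (\<exists>a b k. (a, b) \<in> {(0, 0), (0, 1), (1, 1)} \<and> k \<ge> 2 \<and>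
               unimodularly_equivalent P (spiked_tetrahedron a b k))) \<and>
         (\<forall>a b k. (a, b) \<in> {(0, 0), (0, 1), (1, 1)} \<and> k \<ge> 2 \<longrightarrow>
            int (lattice_size (spiked_tetrahedron a b k)) = k + 5)"
proof (intro conjI allI impI)
  fix P :: "(real ^ 3) set"
  assume P: "spiked P \<and> minimal_polytope P \<and> 7 \<le> lattice_size P"
  then obtain \<alpha> \<beta> where eq: "unimodularly_equivalent (crossed_tetrahedron \<alpha> \<beta>) P"
    using spiked_minimal_projection by blast
  then have "7 \<le> lattice_size (crossed_tetrahedron \<alpha> \<beta>)"
    using P unimodularly_equivalent_lattice_size[OF eq] by simp
  then obtain a b k where "(a, b) \<in> {(0, 0), (0, 1), (1, 1)}" "k \<ge> 2"
    "unimodularly_equivalent (crossed_tetrahedron \<alpha> \<beta>) (spiked_tetrahedron a b k)"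
    by (rule crossed_tetrahedron_normal_form)
  then show "\<exists>a b k. (a, b) \<in> {(0, 0), (0, 1), (1, 1)} \<and> k \<ge> 2 \<and>
      unimodularly_equivalent P (spiked_tetrahedron a b k)"
    using unimodularly_equivalent_trans[OF unimodularly_equivalent_sym[OF eq]] by blast
next
  fix a b k :: int
  assume "(a, b) \<in> {(0, 0), (0, 1), (1, 1)} \<and> k \<ge> 2"
  then show "int (lattice_size (spiked_tetrahedron a b k)) = k + 5"
    using spiked_tetrahedron_size[of a b k] by auto
qed

end
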